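(* Let $M\in\mathbb{R}^{n\times n}$ be RDD or CDD, $b\in\operatorname{range}(M)$ with $b\neq 0$, $t\in\mathbb{R}^n$ with $t\neq 0$, $\varepsilon>0$, and suppose $0<\gamma\le\gamma_{\max}(M)$. To ensure $|t^{\top}x^{\ast}_L-t^{\top}x^{\ast}|\le\frac12\varepsilon$, it suffices to set $$L:=\Theta\!\left(\frac1\gamma\log\!\Big(\frac{1}{\gamma\varepsilon}\,d_{\max}(M)\,\|t\|_0\,\|D_M^{-1}t\|_\infty\,\|b\|_0\,\|D_M^{-1}b\|_\infty\Big)\right)$$ (with suitable absolute constants).
   Context: RDD: positive diagonal and $M(j,j)\ge\sum_{k\ne j}|M(j,k)|$ for all $j$; CDD: $M^{\top}$ is RDD. Write $M=D_M-A_M^{\top}$ with $D_M=\operatorname{diag}(M(1,1),\dots,M(n,n))$ and $A_M^{\top}$ with zero diagonal; $d_{\max}(M)$ is the largest diagonal entry of $M$. Define $x^{\ast}:=\frac12\sum_{\ell=0}^{\infty}(\frac12(I+D_M^{-1}A_M^{\top}))^{\ell}D_M^{-1}b$ (which converges and solves $Mx^\ast=b$) and for integer $L$, $x^{\ast}_L:=\frac12\sum_{\ell=0}^{L-1}(\frac12(I+D_M^{-1}A_M^{\top}))^{\ell}D_M^{-1}b$. For $p\in[1,\infty]$ with Hölder conjugate $q$ ($1/\infty:=0$), $\gamma_p(M):=1-\|\frac12(I+D_M^{-1/q}A_M^{\top}D_M^{-1/p})|_{\operatorname{range}(I-D_M^{-1/q}A_M^{\top}D_M^{-1/p})}\|_p$,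 where for a subspace $U$, $\|X|_U\|_p=\max_{x\in U,\|x\|_p=1}\|Xx\|_p$; $\gamma_{\max}(M):=\max_p\gamma_p(M)$. $\|\cdot\|_0$ is the number of nonzero entries. *)

theory Defs
  imports "Jordan_Normal_Form.Matrix" "HOL-Library.Extended_Real"
begin

text \<open>Matrices carry their dimension as a value rather than in their type, so that a constant
  can be chosen before the dimension \<open>n\<close> is.\<close>

definition RDD :: "real mat \<Rightarrow> bool" where
  "RDD M \<longleftrightarrow> square_mat M \<and>
     (\<forall>j<dim_row M. M $$ (j,j) > 0 \<and>
        M $$ (j,j) \<ge> (\<Sum>k \<in> {..<dim_col M} - {j}. \<bar>M $$ (j,k)\<bar>))"

definition CDD :: "real mat \<Rightarrow> bool" where
  "CDD M \<longleftrightarrow> RDD (transpose_mat M)"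

definition diag_part :: "real mat \<Rightarrow> real mat" where
  "diag_part M = mat_diag (dim_row M) (\<lambda>i. M $$ (i,i))"

text \<open>The real power \<open>D\<^sub>M\<^sup>s\<close> of the diagonal part, meaningful for a positive diagonal.\<close>

definition diag_powr :: "real mat \<Rightarrow> real \<Rightarrow> real mat" where
  "diag_powr M s = mat_diag (dim_row M) (\<lambda>i. M $$ (i,i) powr s)"

text \<open>The matrix \<open>A\<^sub>M\<^sup>T\<close> in the splitting \<open>M = D\<^sub>M - A\<^sub>M\<^sup>T\<close>.\<close>

definition adj_transpose :: "real mat \<Rightarrow> real mat" where
  "adj_transpose M = diag_part M - M"

definition d_max :: "real mat \<Rightarrow> real" where
  "d_max M = Max ((\<lambda>i. M $$ (i,i)) ` {..<dim_row M})"

definition mat_range :: "real mat \<Rightarrow> real vec set" where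
  "mat_range A = (\<lambda>x. A *\<^sub>v x) ` carrier_vec (dim_col A)"

definition nnz :: "real vec \<Rightarrow> nat" where
  "nnz x = card {i. i < dim_vec x \<and> x $ i \<noteq> 0}"

text \<open>In \<^typ>\<open>ereal\<close>, \<open>inverse \<infinity> = 0\<close> and \<open>inverse 0 = \<infinity>\<close>, so \<open>1\<close> and \<open>\<infinity>\<close> are conjugate.\<close>

definition hoelder_conj :: "ereal \<Rightarrow> ereal" where
  "hoelder_conj p = inverse (1 - inverse p)"

definition recip :: "ereal \<Rightarrow> real" where
  "recip p = real_of_ereal (inverse p)"

lemma hoelder_conj:
  assumes "1 \<le> p"
  shows "1 \<le> hoelder_conj p" and "recip p + recip (hoelder_conj p) = 1"
proof -
  have "1 \<le> hoelder_conj p \<and> recip p + recip (hoelder_conj p) = 1"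
  proof (cases p)
    case (real r)
    then have r: "r \<ge> 1" using assms by simp
    then have "inverse r \<le> 1" by (simp add: field_simps)
    with r real show ?thesis
      by (cases "r = 1")
        (auto simp: hoelder_conj_def recip_def one_ereal_def field_simps)
  qed (use assms in \<open>auto simp: hoelder_conj_def recip_def one_ereal_def\<close>)
  then show "1 \<le> hoelder_conj p" "recip p + recip (hoelder_conj p) = 1" by auto
qed

text \<open>Inserting \<open>0\<close> only matters for the empty vector.\<close>

definition pnorm :: "ereal \<Rightarrow> real vec \<Rightarrow> real" where
  "pnorm p x =
     (if p = \<infinity> then Max (insert 0 ((\<lambda>i. \<bar>x $ i\<bar>) ` {..<dim_vec x}))
      else (\<Sum>i<dim_vec x. \<bar>x $ i\<bar> powr real_of_ereal p) powr (1 / real_of_ereal p))"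

text \<open>The supremum is a maximum, the unit sphere of \<open>U\<close> being compact, whenever \<open>U \<noteq> {0}\<close>.\<close>

definition pnorm_restr :: "ereal \<Rightarrow> real mat \<Rightarrow> real vec set \<Rightarrow> real" where
  "pnorm_restr p X U = (SUP x \<in> {x \<in> U. pnorm p x = 1}. pnorm p (X *\<^sub>v x))"

definition scaled_adj :: "ereal \<Rightarrow> real mat \<Rightarrow> real mat" where
  "scaled_adj p M =
     diag_powr M (- recip (hoelder_conj p)) * adj_transpose M * diag_powr M (- recip p)"

definition gap :: "ereal \<Rightarrow> real mat \<Rightarrow> real" where
  "gap p M =
     1 - pnorm_restr p ((1/2) \<cdot>\<^sub>m (1\<^sub>m (dim_row M) + scaled_adj p M))
                       (mat_range (1\<^sub>m (dim_row M) - scaled_adj p M))"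

text \<open>Again a maximum if \<open>M \<noteq> 0\<close> has positive diagonal: \<open>gap p M\<close> is continuous in \<open>p\<close> on the
  compact interval \<open>[1,\<infinity>]\<close>.\<close>

definition gap_max :: "real mat \<Rightarrow> real" where
  "gap_max M = (SUP p \<in> {1..\<infinity>}. gap p M)"

definition neumann_term :: "real mat \<Rightarrow> real vec \<Rightarrow> nat \<Rightarrow> real vec" where
  "neumann_term M b l =
     ((1/2) \<cdot>\<^sub>m (1\<^sub>m (dim_row M) + diag_powr M (-1) * adj_transpose M)) ^\<^sub>m l
       *\<^sub>v (diag_powr M (-1) *\<^sub>v b)"

definition x_star :: "real mat \<Rightarrow> real vec \<Rightarrow> real vec" where
  "x_star M b = vec (dim_row M) (\<lambda>i. 1/2 * (\<Sum>l. neumann_term M b l $ i))"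

definition x_trunc :: "real mat \<Rightarrow> real vec \<Rightarrow> nat \<Rightarrow> real vec" where
  "x_trunc M b L = vec (dim_row M) (\<lambda>i. 1/2 * (\<Sum>l<L. neumann_term M b l $ i))"

end

theory Submission
  imports Defs
begin

text \<open>
  Conjugating by \<open>D\<^sup>1\<^sup>/\<^sup>p\<close> turns \<open>(I + D\<^sup>-\<^sup>1A\<^sup>T)/2\<close> into \<open>(I + S)/2\<close>, where \<open>S\<close> is the scaled matrix of
  \<^const>\<open>gap\<close>, and turns \<open>D\<^sup>-\<^sup>1b\<close> into \<open>D\<^sup>-\<^sup>1\<^sup>/\<^sup>qb\<close>. For \<open>b\<close> in the range of \<open>M\<close> this vector lies in the
  range of \<open>I - S\<close>, which \<open>(I + S)/2\<close> maps into itself, so the \<open>l\<close>-th term of the Neumann series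
  shrinks like \<open>(1 - gap p M)\<^sup>l\<close> in the \<open>p\<close>-norm. Summing the geometric tail and bounding
  \<open>D\<^sup>-\<^sup>1\<^sup>/\<^sup>pt\<close> and \<open>D\<^sup>-\<^sup>1\<^sup>/\<^sup>qb\<close> entrywise shows that the error is at most \<open>Q (1 - \<gamma>)\<^sup>L / (2 \<gamma>)\<close>, where \<open>Q\<close> is
  the product of \<open>d_max M\<close> and the norms in the logarithm. Since \<open>(1 - \<gamma>)\<^sup>L \<le> exp (-\<gamma> L)\<close>, the constant
  \<open>C = 1\<close> suffices. The bound \<open>\<bar>z\<^sub>i\<bar> \<le> \<parallel>z\<parallel>\<^sub>p\<close> takes the place of Hoelder's inequality, because the
  \<open>1\<close>-norm of \<open>D\<^sup>-\<^sup>1\<^sup>/\<^sup>pt\<close> is already within the required \<open>\<parallel>t\<parallel>\<^sub>0\<close> factor.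
\<close>

section \<open>Entrywise estimates for the p-norm\<close>

lemma pnorm_nonneg: "0 \<le> pnorm p x"
  by (auto simp: pnorm_def intro!: Max_ge)

lemma abs_le_pnorm:
  assumes p: "1 \<le> p" and i: "i < dim_vec x"
  shows "\<bar>x $ i\<bar> \<le> pnorm p x"
proof (cases "p = \<infinity>")
  case True
  then show ?thesis using i by (auto simp: pnorm_def intro!: Max_ge)
next
  case False
  define r where "r = real_of_ereal p"
  have r: "r \<ge> 1" using p False by (cases p) (auto simp: r_def one_ereal_def)
  have "\<bar>x $ i\<bar> powr r \<le> (\<Sum>i<dim_vec x. \<bar>x $ i\<bar> powr r)"
    using i by (intro member_le_sum) auto
  then have "(\<bar>x $ i\<bar> powr r) powr (1 / r) \<le> (\<Sum>i<dim_vec x. \<bar>x $ i\<bar> powr r) powr (1 / r)"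
    using r by (intro powr_mono2) auto
  moreover have "(\<bar>x $ i\<bar> powr r) powr (1 / r) = \<bar>x $ i\<bar>"
    using r by (simp add: powr_powr)
  ultimately show ?thesis using False by (simp add: pnorm_def r_def)
qed

lemma pnorm_smult:
  assumes p: "1 \<le> p"
  shows "pnorm p (c \<cdot>\<^sub>v x) = \<bar>c\<bar> * pnorm p x"
proof (cases "p = \<infinity>")
  case True
  let ?A = "insert 0 ((\<lambda>i. \<bar>x $ i\<bar>) ` {..<dim_vec x})"
  have "mono ((*) \<bar>c\<bar>)" by (auto intro!: monoI mult_left_mono)
  then have "\<bar>c\<bar> * Max ?A = Max ((*) \<bar>c\<bar> ` ?A)"
    by (intro mono_Max_commute) auto
  also have "(*) \<bar>c\<bar> ` ?A = insert 0 ((\<lambda>i. \<bar>(c \<cdot>\<^sub>v x) $ i\<bar>) ` {..<dim_vec (c \<cdot>\<^sub>v x)})"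
    by (auto simp: image_image abs_mult intro!: image_eqI)
  finally show ?thesis using True by (simp add: pnorm_def)
next
  case False
  define r where "r = real_of_ereal p"
  have r: "r \<ge> 1" using p False by (cases p) (auto simp: r_def one_ereal_def)
  have "(\<Sum>i<dim_vec (c \<cdot>\<^sub>v x). \<bar>(c \<cdot>\<^sub>v x) $ i\<bar> powr r) = \<bar>c\<bar> powr r * (\<Sum>i<dim_vec x. \<bar>x $ i\<bar> powr r)"
    by (simp add: abs_mult powr_mult sum_distrib_left)
  then have "pnorm p (c \<cdot>\<^sub>v x) = (\<bar>c\<bar> powr r) powr (1 / r) * pnorm p x"
    using False by (simp add: pnorm_def r_def[symmetric] powr_mult sum_nonneg)
  then show ?thesis using r by (simp add: powr_powr)
qed

text \<open>For finite p the power sum gives \<open>nnz x\<close> to the power 1/p as a factor;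
  since a positive count is at least 1, raising the exponent to 1 yields a bound uniform in p. A
  zero count is treated apart, where this monotonicity fails but the norm vanishes.\<close>

lemma pnorm_le_nnz:
  assumes p: "1 \<le> p" and m: "0 \<le> m" and le: "\<And>i. i < dim_vec x \<Longrightarrow> \<bar>x $ i\<bar> \<le> m"
  shows "pnorm p x \<le> real (nnz x) * m"
proof (cases "nnz x = 0")
  case True
  then have z: "x $ i = 0" if "i < dim_vec x" for i
    using that by (auto simp: nnz_def)
  then show ?thesis using True by (auto simp: pnorm_def)
next
  case nz: False
  show ?thesis
  proof (cases "p = \<infinity>")
    case True
    have "pnorm p x \<le> m" using True m le by (auto simp: pnorm_def)
    also have "m \<le> real (nnz x) * m" using nz m by (simp add: mult_le_cancel_right1)
    finally show ?thesis .
  next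
    case False
    define r where "r = real_of_ereal p"
    have r: "r \<ge> 1" using p False by (cases p) (auto simp: r_def one_ereal_def)
    let ?S = "{i. i < dim_vec x \<and> x $ i \<noteq> 0}"
    have "(\<Sum>i<dim_vec x. \<bar>x $ i\<bar> powr r) = (\<Sum>i\<in>?S. \<bar>x $ i\<bar> powr r)"
      by (rule sum.mono_neutral_right) auto
    also have "\<dots> \<le> (\<Sum>i\<in>?S. m powr r)"
      using le r by (intro sum_mono powr_mono2) auto
    also have "\<dots> = real (nnz x) * m powr r" by (simp add: nnz_def)
    finally have "pnorm p x \<le> (real (nnz x) * m powr r) powr (1 / r)"
      using False r by (auto simp: pnorm_def r_def[symmetric] intro!: powr_mono2 sum_nonneg)
    also have "\<dots> = real (nnz x) powr (1 / r) * m"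
      using m r by (simp add: powr_mult powr_powr)
    also have "\<dots> \<le> real (nnz x) powr 1 * m"
      using m r nz by (intro mult_right_mono powr_mono) auto
    finally show ?thesis by simp
  qed
qed

lemma nnz_le_dim: "nnz x \<le> dim_vec x"
proof -
  have "nnz x \<le> card {..<dim_vec x}" unfolding nnz_def by (rule card_mono) auto
  then show ?thesis by simp
qed

text \<open>Taking for \<open>w\<close> the diagonal of \<open>M\<close> to the power -1/p, this
  controls the 1-norm of the scaled \<open>t\<close>.\<close>

lemma sum_abs_le_nnz:
  assumes "dim_vec x = n" and le: "\<And>i. i < n \<Longrightarrow> x $ i \<noteq> 0 \<Longrightarrow> \<bar>x $ i\<bar> * w i \<le> m"
  shows "(\<Sum>i<n. \<bar>x $ i\<bar> * w i) \<le> real (nnz x) * m"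
proof -
  let ?S = "{i. i < n \<and> x $ i \<noteq> 0}"
  have "(\<Sum>i<n. \<bar>x $ i\<bar> * w i) = (\<Sum>i\<in>?S. \<bar>x $ i\<bar> * w i)"
    by (rule sum.mono_neutral_right) auto
  also have "\<dots> \<le> (\<Sum>i\<in>?S. m)" using le by (intro sum_mono) auto
  finally show ?thesis using assms(1) by (simp add: nnz_def)
qed

section \<open>Restricted operator norms and matrix powers\<close>

text \<open>Normalizing \<open>x\<close> reduces this to the definition of
  \<open>pnorm_restr\<close>. Most of the work is to show that the real supremum there is bounded
  above, without which it would bound nothing.\<close>

lemma pnorm_mult_mat_vec_le_restr:
  assumes p: "1 \<le> p" and X: "X \<in> carrier_mat n n" and U: "U \<subseteq> carrier_vec n"
    and scale: "\<And>c u. u \<in> U \<Longrightarrow> c \<cdot>\<^sub>v u \<in> U" and x: "x \<in> U"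
  shows "pnorm p (X *\<^sub>v x) \<le> pnorm_restr p X U * pnorm p x"
proof (cases "pnorm p x = 0")
  case True
  have xc: "x \<in> carrier_vec n" using x U by auto
  have "x $ i = 0" if "i < n" for i
    using abs_le_pnorm[OF p, of i x] that xc True by auto
  then have "x = 0\<^sub>v n" using xc by (intro eq_vecI) auto
  then have "(X *\<^sub>v x) $ i = 0" if "i < n" for i using X that by simp
  then have "pnorm p (X *\<^sub>v x) \<le> real (nnz (X *\<^sub>v x)) * 0"
    using X by (intro pnorm_le_nnz[OF p]) auto
  then show ?thesis using True by simp
next
  case False
  define N where "N = pnorm p x"
  have N: "N > 0" using False pnorm_nonneg[of p x] by (simp add: N_def)
  \<comment> \<open>A crude constant is enough, as only finiteness of the supremum matters: entries
    of a unit vector are at most 1 in absolute value, so \<open>K\<close> dominates every entry of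
    the image.\<close>
  define K where "K = (\<Sum>i<n. \<Sum>j<n. \<bar>X $$ (i,j)\<bar>)"
  have K: "K \<ge> 0" by (simp add: K_def sum_nonneg)
  have "pnorm p (X *\<^sub>v u) \<le> real n * K" if u: "u \<in> U" "pnorm p u = 1" for u
  proof -
    have uc: "u \<in> carrier_vec n" using u U by auto
    have "\<bar>(X *\<^sub>v u) $ i\<bar> \<le> K" if i: "i < n" for i
    proof -
      have "\<bar>(X *\<^sub>v u) $ i\<bar> = \<bar>\<Sum>j<n. X $$ (i,j) * u $ j\<bar>"
        using X uc i by (simp add: scalar_prod_def atLeast0LessThan)
      also have "\<dots> \<le> (\<Sum>j<n. \<bar>X $$ (i,j)\<bar> * \<bar>u $ j\<bar>)"
        by (rule order_trans[OF sum_abs]) (simp add: abs_mult)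
      also have "\<dots> \<le> (\<Sum>j<n. \<bar>X $$ (i,j)\<bar> * 1)"
        using abs_le_pnorm[OF p, of _ u] u uc by (intro sum_mono mult_left_mono) auto
      also have "\<dots> \<le> K" unfolding K_def mult_1_right
        using i by (intro member_le_sum) (auto simp: sum_nonneg)
      finally show ?thesis .
    qed
    then have "pnorm p (X *\<^sub>v u) \<le> real (nnz (X *\<^sub>v u)) * K"
      using X K by (intro pnorm_le_nnz[OF p]) auto
    also have "\<dots> \<le> real n * K"
      using nnz_le_dim[of "X *\<^sub>v u"] X K by (intro mult_right_mono) auto
    finally show ?thesis .
  qed
  then have bdd: "bdd_above ((\<lambda>u. pnorm p (X *\<^sub>v u)) ` {u \<in> U. pnorm p u = 1})"
    by (intro bdd_aboveI2) auto
  have "pnorm p ((1 / N) \<cdot>\<^sub>v x) = 1"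
    using N by (simp add: pnorm_smult[OF p] N_def[symmetric])
  then have "pnorm p (X *\<^sub>v ((1 / N) \<cdot>\<^sub>v x)) \<le> pnorm_restr p X U"
    unfolding pnorm_restr_def using scale x by (intro cSUP_upper[OF _ bdd]) auto
  moreover have "X *\<^sub>v ((1 / N) \<cdot>\<^sub>v x) = (1 / N) \<cdot>\<^sub>v (X *\<^sub>v x)"
    using X x U by (intro mult_mat_vec) auto
  ultimately have "pnorm p (X *\<^sub>v x) / N \<le> pnorm_restr p X U"
    using N by (simp add: pnorm_smult[OF p])
  then show ?thesis using N by (simp add: N_def[symmetric] field_simps)
qed

text \<open>Both \<open>X\<close> and I - S are polynomials in \<open>S\<close>, hence commute, so
  \<open>X\<close> preserves the range of I - S and the restricted norm bound can be iterated. A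
  nonzero \<open>y\<close> forces \<rho> to be nonnegative, because \<rho> times its positive norm
  dominates a norm.\<close>

lemma half_id_plus_pow_contracts:
  fixes S :: "real mat"
  assumes p: "1 \<le> p" and S: "S \<in> carrier_mat n n"
    and y: "y \<in> mat_range (1\<^sub>m n - S)" and y0: "y \<noteq> 0\<^sub>v n"
  defines "X \<equiv> (1/2) \<cdot>\<^sub>m (1\<^sub>m n + S)"
  defines "\<rho> \<equiv> pnorm_restr p X (mat_range (1\<^sub>m n - S))"
  shows "0 \<le> \<rho>" and "pnorm p (X ^\<^sub>m l *\<^sub>v y) \<le> \<rho> ^ l * pnorm p y"
proof -
  let ?T = "1\<^sub>m n - S"
  let ?U = "mat_range ?T"
  have X: "X \<in> carrier_mat n n" and T: "?T \<in> carrier_mat n n" using S by (auto simp: X_def)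
  have U: "?U \<subseteq> carrier_vec n" using mult_mat_vec_carrier[OF T] S by (auto simp: mat_range_def)
  have scale: "c \<cdot>\<^sub>v u \<in> ?U" if "u \<in> ?U" for c u
  proof -
    obtain v where v: "v \<in> carrier_vec n" "u = ?T *\<^sub>v v" using \<open>u \<in> ?U\<close> S by (auto simp: mat_range_def)
    then have "c \<cdot>\<^sub>v u = ?T *\<^sub>v (c \<cdot>\<^sub>v v)" using T by (simp add: mult_mat_vec)
    then show ?thesis using v S by (auto simp: mat_range_def)
  qed
  have comm: "X * ?T = ?T * X"
  proof -
    have "(1\<^sub>m n + S) * ?T = ?T * (1\<^sub>m n + S)"
      using S by (simp add: add_mult_distrib_mat[of _ n n _ _ n] mult_minus_distrib_mat[of _ n n _ n]
          minus_mult_distrib_mat[of _ n n _ _ n] mult_add_distrib_mat[of _ n n _ n] minus_carrier_mat)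
        (auto intro!: eq_matI)
    then show ?thesis using S T
      by (simp add: X_def mult_smult_assoc_mat[of _ n n _ n] mult_smult_distrib[of _ n n _ n])
  qed
  have inv: "X *\<^sub>v u \<in> ?U" if "u \<in> ?U" for u
  proof -
    obtain v where v: "v \<in> carrier_vec n" "u = ?T *\<^sub>v v" using \<open>u \<in> ?U\<close> S by (auto simp: mat_range_def)
    then have "X *\<^sub>v u = ?T *\<^sub>v (X *\<^sub>v v)"
      using X T comm by (metis assoc_mult_mat_vec)
    then show ?thesis using v X S by (auto simp: mat_range_def)
  qed
  have step: "pnorm p (X *\<^sub>v u) \<le> \<rho> * pnorm p u" if "u \<in> ?U" for u
    unfolding \<rho>_def using pnorm_mult_mat_vec_le_restr[OF p X U scale that] by simp
  show \<rho>: "0 \<le> \<rho>"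
  proof -
    have yc: "y \<in> carrier_vec n" using y U by auto
    obtain i where "i < n" "y $ i \<noteq> 0" using y0 yc by (metis carrier_vecD eq_vecI index_zero_vec)
    then have "0 < pnorm p y" using abs_le_pnorm[OF p, of i y] yc by auto
    moreover have "0 \<le> \<rho> * pnorm p y" using step[OF y] pnorm_nonneg[of p "X *\<^sub>v y"] by linarith
    ultimately show ?thesis by (simp add: zero_le_mult_iff)
  qed
  show "pnorm p (X ^\<^sub>m l *\<^sub>v y) \<le> \<rho> ^ l * pnorm p y"
    using y
  proof (induction l arbitrary: y)
    case 0
    then show ?case using X U by auto
  next
    case (Suc l)
    have "X ^\<^sub>m Suc l *\<^sub>v y = X ^\<^sub>m l *\<^sub>v (X *\<^sub>v y)"
      using X Suc.prems U by (simp add: assoc_mult_mat_vec[of _ n n _ n] subset_iff)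
    then have "pnorm p (X ^\<^sub>m Suc l *\<^sub>v y) \<le> \<rho> ^ l * pnorm p (X *\<^sub>v y)"
      using Suc.IH[OF inv[OF Suc.prems]] by simp
    also have "\<dots> \<le> \<rho> ^ l * (\<rho> * pnorm p y)"
      using step[OF Suc.prems] \<rho> by (intro mult_left_mono) auto
    finally show ?case by (simp add: algebra_simps)
  qed
qed

text \<open>Similarity expressed without an inverse of \<open>E\<close>: the relation moves
  \<open>E\<close> past one factor at a time.\<close>

lemma pow_mat_intertwine:
  fixes A B E :: "'a :: semiring_1 mat"
  assumes A: "A \<in> carrier_mat n n" and B: "B \<in> carrier_mat n n" and E: "E \<in> carrier_mat n n"
    and AE: "A * E = E * B"
  shows "A ^\<^sub>m l * E = E * B ^\<^sub>m l"
proof (induction l)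
  case 0
  then show ?case using A B E by simp
next
  case (Suc l)
  have "A ^\<^sub>m Suc l * E = A ^\<^sub>m l * (E * B)"
    using A B E AE by (simp add: assoc_mult_mat[of _ n n _ n _ n])
  also have "\<dots> = A ^\<^sub>m l * E * B"
    using A B E by (intro assoc_mult_mat[of _ n n _ n _ n, symmetric]) auto
  also have "\<dots> = E * B ^\<^sub>m l * B" by (simp only: Suc)
  finally show ?case using B E by (simp add: assoc_mult_mat[of _ n n _ n _ n])
qed

section \<open>Powers of the diagonal part\<close>

lemma diag_powr_carrier [simp]: "M \<in> carrier_mat n n \<Longrightarrow> diag_powr M s \<in> carrier_mat n n"
  by (simp add: diag_powr_def)

lemma diag_powr_mult: "diag_powr M r * diag_powr M s = diag_powr M (r + s)"
  by (simp add: diag_powr_def powr_add)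

lemma diag_powr_mult_vec_index:
  "v \<in> carrier_vec (dim_row M) \<Longrightarrow> i < dim_row M \<Longrightarrow>
    (diag_powr M s *\<^sub>v v) $ i = M $$ (i,i) powr s * v $ i"
  by (auto simp: diag_powr_def mat_diag_def scalar_prod_def if_distrib[of "\<lambda>a. a * _"] sum.delta cong: if_cong)

lemma dim_row_diag_powr [simp]: "dim_row (diag_powr M s) = dim_row M"
  by (simp add: diag_powr_def mat_diag_def)

lemma dominant_diag_pos:
  assumes "M \<in> carrier_mat n n" "RDD M \<or> CDD M" "i < n"
  shows "M $$ (i,i) > 0"
  using assms by (auto simp: CDD_def RDD_def)

lemma le_d_max: "i < dim_row M \<Longrightarrow> M $$ (i,i) \<le> d_max M"
  by (auto simp: d_max_def intro!: Max_ge)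

lemma recip_conj:
  assumes "1 \<le> p"
  shows "recip (hoelder_conj p) = 1 - recip p"
  using hoelder_conj(2)[OF assms] by simp

lemma recip_bounds:
  assumes "1 \<le> p"
  shows "0 \<le> recip p" "recip p \<le> 1"
  using assms by (cases p; auto simp: recip_def one_ereal_def field_simps)+

section \<open>Scaling a matrix with positive diagonal\<close>

locale pos_diag_mat =
  fixes M :: "real mat" and n :: nat
  assumes M: "M \<in> carrier_mat n n" and diag_pos: "\<And>i. i < n \<Longrightarrow> M $$ (i,i) > 0"
begin

lemma dims [simp]: "dim_row M = n" "dim_col M = n"
  using M by auto

lemma diag_powr_in [simp]: "diag_powr M s \<in> carrier_mat n n"
  using M by simp

lemma adj_transpose_in [simp]: "adj_transpose M \<in> carrier_mat n n"
  using M by (simp add: adj_transpose_def diag_part_def minus_carrier_mat)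

lemma scaled_adj_in [simp]: "scaled_adj p M \<in> carrier_mat n n"
  unfolding scaled_adj_def by (intro mult_carrier_mat[of _ n n]) auto

text \<open>Positivity enters because \<open>0 powr 0\<close> is 0 in HOL.\<close>

lemma diag_powr_0: "diag_powr M 0 = 1\<^sub>m n"
  using diag_pos by (intro eq_matI) (force simp: diag_powr_def mat_diag_def)+

lemma diag_powr_1: "diag_powr M 1 = diag_part M"
  using diag_pos by (intro eq_matI) (force simp: diag_powr_def diag_part_def mat_diag_def)+

lemma split_diag_adj: "M = diag_powr M 1 - adj_transpose M"
  unfolding diag_powr_1 using M by (intro eq_matI) (auto simp: adj_transpose_def diag_part_def mat_diag_def)

text \<open>Write D for the diagonal part, S for \<open>scaled_adj p M\<close> and q for the
  conjugate of p. Since 1 - 1/q = 1/p, the splitting of \<open>M\<close> gives D^(-1/q) M = (I - S)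
  D^(1/p), so a preimage x of \<open>b\<close> under \<open>M\<close> yields the preimage D^(1/p) x
  under I - S.\<close>

lemma scaled_rhs_in_range:
  assumes p: "1 \<le> p" and b: "b \<in> mat_range M"
  shows "diag_powr M (- recip (hoelder_conj p)) *\<^sub>v b \<in> mat_range (1\<^sub>m n - scaled_adj p M)"
proof -
  let ?q = "diag_powr M (- recip (hoelder_conj p))" and ?A = "adj_transpose M"
  let ?e = "diag_powr M (recip p)"
  obtain x where x: "x \<in> carrier_vec n" "b = M *\<^sub>v x" using b by (auto simp: mat_range_def)
  have "scaled_adj p M * ?e = ?q * ?A * (diag_powr M (- recip p) * ?e)"
    unfolding scaled_adj_def by (intro assoc_mult_mat[of _ n n _ n _ n] mult_carrier_mat[of _ n n]) auto
  then have Se: "scaled_adj p M * ?e = ?q * ?A"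
    by (simp add: diag_powr_mult diag_powr_0 right_mult_one_mat[of _ n n] mult_carrier_mat[of _ n n])
  have "(1\<^sub>m n - scaled_adj p M) * ?e = ?e - ?q * ?A"
    by (simp add: minus_mult_distrib_mat[of _ n n _ _ n] Se left_mult_one_mat[of _ n n])
  also have "\<dots> = ?q * diag_powr M 1 - ?q * ?A"
    using recip_conj[OF p] by (simp add: diag_powr_mult)
  also have "\<dots> = ?q * (diag_powr M 1 - ?A)"
    by (simp add: mult_minus_distrib_mat[of _ n n _ n])
  also have "\<dots> = ?q * M" by (simp add: split_diag_adj[symmetric])
  finally have eq: "?q * M = (1\<^sub>m n - scaled_adj p M) * ?e" by simp
  have "?q *\<^sub>v b = (?q * M) *\<^sub>v x"
    using x M by (simp add: assoc_mult_mat_vec[of _ n n _ n])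
  also have "\<dots> = (1\<^sub>m n - scaled_adj p M) *\<^sub>v (?e *\<^sub>v x)"
    unfolding eq using x by (intro assoc_mult_mat_vec[of _ n n _ n]) (auto intro: minus_carrier_mat)
  finally show ?thesis using x
    by (auto simp: mat_range_def carrier_matD(2)[OF scaled_adj_in] intro!: image_eqI mult_mat_vec_carrier[of _ n n])
qed

text \<open>The factorization D^(-1) = D^(-1/p) D^(-1/q) shows that D^(-1/p) intertwines the two
  iteration matrices. Applied to D^(-1) b, it also supplies the factor D^(-1/p) that is moved
  through the power.\<close>

lemma neumann_term_conjugated:
  assumes p: "1 \<le> p" and b: "b \<in> carrier_vec n"
  shows "neumann_term M b l = diag_powr M (- recip p) *\<^sub>v
    (((1/2) \<cdot>\<^sub>m (1\<^sub>m n + scaled_adj p M)) ^\<^sub>m l *\<^sub>v (diag_powr M (- recip (hoelder_conj p)) *\<^sub>v b))"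
proof -
  let ?q = "diag_powr M (- recip (hoelder_conj p))" and ?A = "adj_transpose M"
  let ?E = "diag_powr M (- recip p)" and ?D = "diag_powr M (-1)"
  let ?W = "(1/2) \<cdot>\<^sub>m (1\<^sub>m n + ?D * ?A)" and ?V = "(1/2) \<cdot>\<^sub>m (1\<^sub>m n + scaled_adj p M)"
  have Eq: "?E * ?q = ?D" using recip_conj[OF p] by (simp add: diag_powr_mult)
  have DA: "?D * ?A \<in> carrier_mat n n" by (intro mult_carrier_mat[of _ n n]) auto
  have W: "?W \<in> carrier_mat n n" and V: "?V \<in> carrier_mat n n" using DA by auto
  have "?E * scaled_adj p M = ?D * ?A * ?E"
    unfolding scaled_adj_def Eq[symmetric]
    by (simp add: assoc_mult_mat[of _ n n _ n _ n] mult_carrier_mat[of _ n n _ n])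
  then have "?W * ?E = ?E * ?V"
    using DA by (simp add: mult_smult_assoc_mat[of _ n n _ n] mult_smult_distrib[of _ n n _ n]
        add_mult_distrib_mat[of _ n n _ _ n] mult_add_distrib_mat[of _ n n _ n]
        left_mult_one_mat[of _ n n] right_mult_one_mat[of _ n n])
  then have pow: "?W ^\<^sub>m l * ?E = ?E * ?V ^\<^sub>m l"
    by (intro pow_mat_intertwine[OF W V]) auto
  have qb: "?q *\<^sub>v b \<in> carrier_vec n" using b by (intro mult_mat_vec_carrier[of _ n n]) auto
  have "neumann_term M b l = ?W ^\<^sub>m l *\<^sub>v (?E *\<^sub>v (?q *\<^sub>v b))"
    unfolding neumann_term_def dims Eq[symmetric] using b by (simp add: assoc_mult_mat_vec[of _ n n _ n])
  also have "\<dots> = (?W ^\<^sub>m l * ?E) *\<^sub>v (?q *\<^sub>v b)"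
    using W qb by (intro assoc_mult_mat_vec[of _ n n _ n, symmetric]) auto
  also have "\<dots> = ?E *\<^sub>v (?V ^\<^sub>m l *\<^sub>v (?q *\<^sub>v b))"
    unfolding pow using V qb by (intro assoc_mult_mat_vec[of _ n n _ n]) auto
  finally show ?thesis .
qed

lemma diag_powr_mult_vec_nonzero:
  assumes "b \<in> carrier_vec n" "b \<noteq> 0\<^sub>v n"
  shows "diag_powr M s *\<^sub>v b \<noteq> 0\<^sub>v n"
proof
  assume eq: "diag_powr M s *\<^sub>v b = 0\<^sub>v n"
  have "b $ i = 0" if "i < n" for i
    using arg_cong[OF eq, of "\<lambda>v. v $ i"] diag_pos[OF that] that assms(1)
    by (simp add: diag_powr_mult_vec_index del: index_mult_mat_vec)
  then have "b = 0\<^sub>v n" using assms(1) by (intro eq_vecI) auto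
  with assms(2) show False by simp
qed

lemma nnz_diag_powr_mult_vec_le:
  assumes "b \<in> carrier_vec n"
  shows "nnz (diag_powr M s *\<^sub>v b) \<le> nnz b"
  unfolding nnz_def using assms
  by (intro card_mono) (auto simp: diag_powr_mult_vec_index simp del: index_mult_mat_vec)

section \<open>The truncation error for a fixed exponent\<close>

text \<open>Split off one factor D^(-1) into the sup norm and bound the remaining power by
  \<open>d_max M\<close>. It is applied to \<open>t\<close> with s = 1 - 1/p and to \<open>b\<close>
  with s = 1/p, so the two powers of \<open>d_max M\<close> multiply to its first power.\<close>

lemma abs_powr_mult_le:
  assumes v: "v \<in> carrier_vec n" and i: "i < n" and s: "0 \<le> s"
  shows "M $$ (i,i) powr (s - 1) * \<bar>v $ i\<bar> \<le> d_max M powr s * pnorm \<infinity> (diag_powr M (-1) *\<^sub>v v)"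
proof -
  have "M $$ (i,i) powr (s - 1) * \<bar>v $ i\<bar> = M $$ (i,i) powr s * \<bar>(diag_powr M (-1) *\<^sub>v v) $ i\<bar>"
    using v i diag_pos[OF i] by (simp add: diag_powr_mult_vec_index abs_mult powr_diff powr_minus_divide
        del: index_mult_mat_vec)
  also have "\<dots> \<le> d_max M powr s * pnorm \<infinity> (diag_powr M (-1) *\<^sub>v v)"
    using i s le_d_max[of i M] diag_pos[OF i]
    by (intro mult_mono powr_mono2 abs_le_pnorm) auto
  finally show ?thesis .
qed

text \<open>The scaled \<open>b\<close> is a nonzero vector in the range of I - S, which makes the
  restricted norm nonnegative. Uniformity in p is what later bounds the supremum in
  \<open>gap_max\<close>.\<close>

lemma gap_le_1_of_range:
  assumes p: "1 \<le> p" and b: "b \<in> mat_range M" "b \<noteq> 0\<^sub>v n"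
  shows "gap p M \<le> 1"
proof -
  have bc: "b \<in> carrier_vec n" using b M by (auto simp: mat_range_def intro: mult_mat_vec_carrier)
  show ?thesis
    using half_id_plus_pow_contracts(1)[OF p scaled_adj_in scaled_rhs_in_range[OF p b(1)]
        diag_powr_mult_vec_nonzero[OF bc b(2)]]
    by (simp add: gap_def)
qed

text \<open>On the right, p survives only in the gap, so it can be chosen afterwards to bring the
  gap near its supremum.\<close>

lemma truncation_error_le:
  assumes p: "1 \<le> p" and b: "b \<in> mat_range M" "b \<noteq> 0\<^sub>v n" and t: "t \<in> carrier_vec n"
    and g: "0 < gap p M"
  shows "\<bar>t \<bullet> x_trunc M b L - t \<bullet> x_star M b\<bar> \<le>
    1/2 * (d_max M * real (nnz t) * pnorm \<infinity> (diag_powr M (-1) *\<^sub>v t)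
           * real (nnz b) * pnorm \<infinity> (diag_powr M (-1) *\<^sub>v b)) * (1 - gap p M) ^ L / gap p M"
proof -
  define \<rho> where "\<rho> = 1 - gap p M"
  define y where "y = diag_powr M (- recip (hoelder_conj p)) *\<^sub>v b"
  define V where "V = (1/2) \<cdot>\<^sub>m (1\<^sub>m n + scaled_adj p M)"
  define N where "N = pnorm p y"
  define w where "w i = M $$ (i,i) powr (- recip p)" for i
  define r where "r = recip p"
  define T where "T = pnorm \<infinity> (diag_powr M (-1) *\<^sub>v t)"
  define B where "B = pnorm \<infinity> (diag_powr M (-1) *\<^sub>v b)"
  have r: "0 \<le> r" "r \<le> 1" "recip (hoelder_conj p) = 1 - r"
    using recip_bounds[OF p] recip_conj[OF p] by (auto simp: r_def)
  have bc: "b \<in> carrier_vec n" using b M by (auto simp: mat_range_def intro: mult_mat_vec_carrier)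
  have yc: "y \<in> carrier_vec n" unfolding y_def using bc by (rule mult_mat_vec_carrier[OF diag_powr_in])
  have V: "V \<in> carrier_mat n n" by (simp add: V_def)
  have \<rho>0: "0 \<le> \<rho>" using gap_le_1_of_range[OF p b] by (simp add: \<rho>_def)
  have \<rho>1: "\<rho> < 1" using g by (simp add: \<rho>_def)
  have contr: "pnorm p (V ^\<^sub>m l *\<^sub>v y) \<le> \<rho> ^ l * N" for l
    using half_id_plus_pow_contracts(2)[OF p scaled_adj_in scaled_rhs_in_range[OF p b(1)]
        diag_powr_mult_vec_nonzero[OF bc b(2)], of l]
    by (simp add: gap_def \<rho>_def V_def N_def y_def)
  have term_le: "\<bar>neumann_term M b l $ i\<bar> \<le> w i * (\<rho> ^ l * N)" if i: "i < n" for l i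
  proof -
    have Vy: "V ^\<^sub>m l *\<^sub>v y \<in> carrier_vec n" using V yc by (intro mult_mat_vec_carrier[of _ n n]) auto
    have "neumann_term M b l $ i = w i * (V ^\<^sub>m l *\<^sub>v y) $ i"
      using Vy i unfolding neumann_term_conjugated[OF p bc] V_def y_def w_def
      by (subst diag_powr_mult_vec_index) auto
    moreover have "\<bar>(V ^\<^sub>m l *\<^sub>v y) $ i\<bar> \<le> \<rho> ^ l * N"
      using abs_le_pnorm[OF p, of i "V ^\<^sub>m l *\<^sub>v y"] contr[of l] Vy i
      by (simp add: carrier_vecD[OF Vy] del: index_mult_mat_vec dim_mult_mat_vec)
    ultimately show ?thesis by (auto simp: abs_mult w_def intro!: mult_left_mono)
  qed
  have geo: "summable (\<lambda>l. w i * (\<rho> ^ l * N))" for i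
    using \<rho>0 \<rho>1 by (intro summable_mult summable_mult2 summable_geometric) auto
  have tail: "\<bar>(\<Sum>l<L. neumann_term M b l $ i) - (\<Sum>l. neumann_term M b l $ i)\<bar>
      \<le> w i * (\<rho> ^ L * N / (1 - \<rho>))" if i: "i < n" for i
  proof -
    let ?f = "\<lambda>l. neumann_term M b l $ i"
    \<comment> \<open>Comparison with the geometric series makes the \<open>suminf\<close> in
      \<open>x_star\<close> a genuine limit, so that the tail from index \<open>L\<close> on is the
      truncation error.\<close>
    have sf: "summable ?f" using term_le[OF i] by (intro summable_comparison_test'[OF geo[of i]]) auto
    have "(\<lambda>l. w i * (\<rho> ^ (l + L) * N)) sums (w i * (\<rho> ^ L * (1 / (1 - \<rho>)) * N))"
      unfolding power_add mult.commute[of "\<rho> ^ _" "\<rho> ^ L"]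
      using \<rho>0 \<rho>1 by (intro sums_mult sums_mult2 geometric_sums) auto
    then have gs: "(\<lambda>l. w i * (\<rho> ^ (l + L) * N)) sums (w i * (\<rho> ^ L * N / (1 - \<rho>)))"
      by (simp add: field_simps)
    have "\<bar>\<Sum>l. ?f (l + L)\<bar> \<le> (\<Sum>l. w i * (\<rho> ^ (l + L) * N))"
      using norm_suminf_le[of "\<lambda>l. ?f (l + L)" "\<lambda>l. w i * (\<rho> ^ (l + L) * N)"] term_le[OF i] gs
      by (auto simp: sums_iff)
    then show ?thesis
      using suminf_minus_initial_segment[OF sf, of L] gs by (simp add: sums_iff)
  qed
  have err: "\<bar>t \<bullet> x_trunc M b L - t \<bullet> x_star M b\<bar> \<le> 1/2 * (\<Sum>i<n. \<bar>t $ i\<bar> * w i) * (\<rho> ^ L * N / (1 - \<rho>))"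
  proof -
    let ?e = "\<lambda>i. (\<Sum>l<L. neumann_term M b l $ i) - (\<Sum>l. neumann_term M b l $ i)"
    have "t \<bullet> x_trunc M b L - t \<bullet> x_star M b = (\<Sum>i<n. 1/2 * (t $ i * ?e i))"
      by (simp add: scalar_prod_def x_trunc_def x_star_def atLeast0LessThan
          sum_subtractf[symmetric] algebra_simps diff_divide_distrib)
    also have "\<bar>\<dots>\<bar> \<le> (\<Sum>i<n. 1/2 * (\<bar>t $ i\<bar> * \<bar>?e i\<bar>))"
      by (rule order_trans[OF sum_abs]) (simp add: abs_mult)
    also have "\<dots> \<le> (\<Sum>i<n. 1/2 * (\<bar>t $ i\<bar> * (w i * (\<rho> ^ L * N / (1 - \<rho>)))))"
      using tail by (intro sum_mono mult_left_mono) auto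
    also have "\<dots> = 1/2 * (\<Sum>i<n. \<bar>t $ i\<bar> * w i) * (\<rho> ^ L * N / (1 - \<rho>))"
      by (simp only: sum_distrib_left sum_distrib_right mult.assoc)
    finally show ?thesis .
  qed
  have T0: "0 \<le> T" and B0: "0 \<le> B" by (auto simp: T_def B_def pnorm_nonneg)
  have tw: "(\<Sum>i<n. \<bar>t $ i\<bar> * w i) \<le> real (nnz t) * (d_max M powr (1 - r) * T)"
  proof (rule sum_abs_le_nnz)
    show "dim_vec t = n" using t by simp
    show "\<bar>t $ i\<bar> * w i \<le> d_max M powr (1 - r) * T" if "i < n" for i
      using abs_powr_mult_le[OF t that, of "1 - r"] r
      by (simp add: w_def T_def r_def[symmetric] mult.commute)
  qed
  have "N \<le> real (nnz y) * (d_max M powr r * B)"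
    unfolding N_def
  proof (rule pnorm_le_nnz[OF p])
    show "0 \<le> d_max M powr r * B" using B0 by simp
    show "\<bar>y $ i\<bar> \<le> d_max M powr r * B" if "i < dim_vec y" for i
      using abs_powr_mult_le[OF bc, of i r] r yc bc that
      by (simp add: y_def B_def diag_powr_mult_vec_index abs_mult del: index_mult_mat_vec)
  qed
  also have "\<dots> \<le> real (nnz b) * (d_max M powr r * B)"
    using nnz_diag_powr_mult_vec_le[OF bc] B0 by (intro mult_right_mono) (auto simp: y_def)
  finally have Nb: "N \<le> real (nnz b) * (d_max M powr r * B)" .
  \<comment> \<open>The maximum in \<open>d_max\<close> must range over a nonempty set to be
    positive; positivity is then used to add the exponents 1 - r and r.\<close>
  have "n > 0" using b(2) bc by (cases n) auto
  then have d: "d_max M > 0" using le_d_max[of 0 M] diag_pos[of 0] by simp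
  have "1/2 * (\<Sum>i<n. \<bar>t $ i\<bar> * w i) * (\<rho> ^ L * N / (1 - \<rho>))
      \<le> 1/2 * (real (nnz t) * (d_max M powr (1 - r) * T))
          * (\<rho> ^ L * (real (nnz b) * (d_max M powr r * B)) / (1 - \<rho>))"
    using tw Nb \<rho>0 \<rho>1 T0 B0 pnorm_nonneg[of p y]
    by (intro mult_mono divide_right_mono mult_left_mono)
      (auto simp: N_def w_def intro!: sum_nonneg mult_nonneg_nonneg divide_nonneg_nonneg)
  also have "\<dots> = 1/2 * ((d_max M powr (1 - r) * d_max M powr r) * real (nnz t) * T
           * real (nnz b) * B) * \<rho> ^ L / (1 - \<rho>)" by simp
  also have "d_max M powr (1 - r) * d_max M powr r = d_max M"
    using d by (simp add: powr_add[symmetric])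
  finally show ?thesis using err by (simp add: T_def B_def \<rho>_def)
qed

end

section \<open>From the error bound to the choice of \<open>L\<close>\<close>

theorem theorem1p3:
  shows "\<exists>C::real. C > 0 \<and>
    (\<forall>(n::nat) (M::real mat) (b::real vec) (t::real vec) (\<epsilon>::real) (\<gamma>::real) (L::nat).
       M \<in> carrier_mat n n \<longrightarrow> RDD M \<or> CDD M \<longrightarrow>
       b \<in> mat_range M \<longrightarrow> b \<noteq> 0\<^sub>v n \<longrightarrow>
       t \<in> carrier_vec n \<longrightarrow> t \<noteq> 0\<^sub>v n \<longrightarrow>
       \<epsilon> > 0 \<longrightarrow> 0 < \<gamma> \<longrightarrow> \<gamma> \<le> gap_max M \<longrightarrow>
       real L \<ge> C * (1 / \<gamma> * ln (1 / (\<gamma> * \<epsilon>) * d_max M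
                   * real (nnz t) * pnorm \<infinity> (diag_powr M (-1) *\<^sub>v t)
                   * real (nnz b) * pnorm \<infinity> (diag_powr M (-1) *\<^sub>v b))) \<longrightarrow>
       \<bar>t \<bullet> x_trunc M b L - t \<bullet> x_star M b\<bar> \<le> 1/2 * \<epsilon>)"
proof (intro exI[of _ 1] conjI allI impI)
  fix n :: nat and M :: "real mat" and b t :: "real vec" and \<epsilon> \<gamma> :: real and L :: nat
  assume M: "M \<in> carrier_mat n n" and dom: "RDD M \<or> CDD M"
    and b: "b \<in> mat_range M" "b \<noteq> 0\<^sub>v n" and t: "t \<in> carrier_vec n"
    and \<epsilon>: "\<epsilon> > 0" and \<gamma>: "0 < \<gamma>" "\<gamma> \<le> gap_max M"
    and L: "real L \<ge> 1 * (1 / \<gamma> * ln (1 / (\<gamma> * \<epsilon>) * d_max M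
                   * real (nnz t) * pnorm \<infinity> (diag_powr M (-1) *\<^sub>v t)
                   * real (nnz b) * pnorm \<infinity> (diag_powr M (-1) *\<^sub>v b)))"
  interpret pos_diag_mat M n
    using M dominant_diag_pos[OF M dom] by unfold_locales auto
  define Q where "Q = d_max M * real (nnz t) * pnorm \<infinity> (diag_powr M (-1) *\<^sub>v t)
           * real (nnz b) * pnorm \<infinity> (diag_powr M (-1) *\<^sub>v b)"
  let ?err = "\<bar>t \<bullet> x_trunc M b L - t \<bullet> x_star M b\<bar>"
  have L': "ln (Q / (\<gamma> * \<epsilon>)) \<le> \<gamma> * real L"
    using L \<gamma> by (simp add: Q_def field_simps)
  have bc: "b \<in> carrier_vec n" using b M by (auto simp: mat_range_def intro: mult_mat_vec_carrier)
  have "n > 0" using b(2) bc by (cases n) auto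
  then have "d_max M > 0" using le_d_max[of 0 M] diag_pos[of 0] by simp
  then have Q0: "Q \<ge> 0" by (simp add: Q_def pnorm_nonneg)
  \<comment> \<open>Boundedness lets any h below \<open>gap_max M\<close> be exceeded by the gap of
    some p.\<close>
  have bdd: "bdd_above ((\<lambda>p. gap p M) ` {1..\<infinity>})"
    using gap_le_1_of_range[OF _ b] by (intro bdd_aboveI2[of _ _ 1]) auto
  have \<gamma>1: "\<gamma> \<le> 1"
    using \<gamma>(2) cSUP_least[of "{1..\<infinity>}" "\<lambda>p. gap p M" 1] gap_le_1_of_range[OF _ b]
    by (fastforce simp: gap_max_def)
  \<comment> \<open>A constant factor lost in \<open>\<gamma>\<close> could not be absorbed into \<open>C\<close> when the logarithm is near or
    below \<open>0\<close>; approximating the supremum and passing to the limit avoids the loss.\<close>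
  have approx: "?err \<le> 1/2 * Q * (1 - h) ^ L / h" if h: "0 < h" "h < \<gamma>" for h
  proof -
    obtain p where p: "1 \<le> p" "h < gap p M"
      using h \<gamma>(2) less_cSUP_iff[OF _ bdd, of h] by (force simp: gap_max_def)
    have "?err \<le> 1/2 * Q * (1 - gap p M) ^ L / gap p M"
      using truncation_error_le[OF p(1) b t, of L] p h by (simp add: Q_def)
    \<comment> \<open>The function (1 - x)^L / x is nonincreasing for 0 < x \<le> 1, and the gap of
      p lies in that range above h.\<close>
    also have "\<dots> \<le> 1/2 * Q * (1 - h) ^ L / h"
      using p h Q0 gap_le_1_of_range[OF p(1) b]
      by (intro frac_le mult_left_mono power_mono mult_nonneg_nonneg) auto
    finally show ?thesis .
  qed
  have "((\<lambda>h. 1/2 * Q * (1 - h) ^ L / h) \<longlongrightarrow> 1/2 * Q * (1 - \<gamma>) ^ L / \<gamma>) (at_left \<gamma>)"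
    using \<gamma> by (intro tendsto_intros) auto
  moreover have "eventually (\<lambda>h. ?err \<le> 1/2 * Q * (1 - h) ^ L / h) (at_left \<gamma>)"
    using eventually_at_left_real[OF \<gamma>(1)] by eventually_elim (use approx in auto)
  ultimately have "?err \<le> 1/2 * Q * (1 - \<gamma>) ^ L / \<gamma>"
    by (intro tendsto_lowerbound) auto
  also have "\<dots> = 1/2 * \<epsilon> * (Q / (\<gamma> * \<epsilon>) * (1 - \<gamma>) ^ L)"
    using \<epsilon> by simp
  also have "Q / (\<gamma> * \<epsilon>) * (1 - \<gamma>) ^ L \<le> 1"
  \<comment> \<open>Exponentiating the logarithm needs a positive argument; for \<open>Q = 0\<close>
    the product simply vanishes.\<close>
  proof (cases "Q = 0")
    case False
    then have R: "Q / (\<gamma> * \<epsilon>) > 0" using Q0 \<gamma> \<epsilon> by simp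
    have "(1 - \<gamma>) ^ L \<le> exp (- \<gamma>) ^ L"
      using \<gamma>1 exp_ge_add_one_self[of "- \<gamma>"] by (intro power_mono) auto
    also have "\<dots> = exp (- (\<gamma> * real L))" by (simp add: exp_of_nat_mult[symmetric] mult.commute)
    \<comment> \<open>Here the lower bound on \<open>L\<close> enters: the decay cancels the factor
      \<open>Q / (\<gamma> * \<epsilon>)\<close>.\<close>
    also have "\<dots> \<le> exp (- ln (Q / (\<gamma> * \<epsilon>)))" using L' by simp
    also have "\<dots> = inverse (Q / (\<gamma> * \<epsilon>))" using R by (simp only: exp_minus exp_ln)
    finally have "Q / (\<gamma> * \<epsilon>) * (1 - \<gamma>) ^ L \<le> Q / (\<gamma> * \<epsilon>) * inverse (Q / (\<gamma> * \<epsilon>))"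
      using R by (intro mult_left_mono) auto
    also have "\<dots> = 1" using R by (intro right_inverse) (rule less_imp_neq[symmetric])
    finally show ?thesis .
  qed simp
  then have "1/2 * \<epsilon> * (Q / (\<gamma> * \<epsilon>) * (1 - \<gamma>) ^ L) \<le> 1/2 * \<epsilon> * 1"
    using \<epsilon> by (intro mult_left_mono) auto
  finally show "?err \<le> 1/2 * \<epsilon>" by simp
qed simp

end
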